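(* Let $\mathbb{F}_q$ be a finite field with $q$ elements and let $n\in\mathbb{N}$. The convex hull (in $\mathbb{R}[t]$) of the set of all characteristic polynomials of hyperplane arrangements in $\mathbb{F}_q^n$ is equal to the simplex $$\left\{\sum_{k=0}^n\theta_k\,\chi^q_{n,k}(t):\ \theta_k\ge0\text{ for all }k,\text{ and }\theta_0+\theta_1+\cdots+\theta_n=1\right\},$$ where $\chi^q_{n,0}(t)=t^n$ and $\chi^q_{n,k}(t)=t^{n-k}(t-1)(t-q)\cdots(t-q^{k-1})$ for $1\le k\le n$.
   Context: A hyperplane arrangement in $\mathbb{F}_q^n$ is a finite (possibly empty) list $\mathcal{H}=\{H_1,\dots,H_m\}$ of linear hyperplanes, i.e. subspaces of $\mathbb{F}_q^n$ of dimension $n-1$. Its characteristic polynomial is $$\chi_{\mathcal H}(t)=\sum_{A\subseteq\{1,\dots,m\}}(-1)^{|A|}\,t^{\dim(\bigcap_{i\in A}H_i)},$$ where the empty intersection is $\mathbb{F}_q^n$. *)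

theory Defs
  imports
    "HOL-Analysis.Analysis"
    "HOL-Library.Function_Algebras"
    "HOL-Computational_Algebra.Polynomial"
begin

text \<open>
  The real vector space structure on polynomials is what gives \<^term>\<open>(hull)\<close> with
  \<^const>\<open>convex\<close> and \<^const>\<open>affine_dependent\<close> their meaning in \<open>\<real>[t]\<close>.  On \<^typ>\<open>real poly\<close> the
  scalar multiplication is \<^const>\<open>smult\<close>, see \<open>scaleR_real_poly\<close> below.
\<close>

instantiation poly :: (real_vector) real_vector
begin

definition scaleR_poly :: "real \<Rightarrow> 'a poly \<Rightarrow> 'a poly" where
  "scaleR_poly c p = map_poly (scaleR c) p"

instance
  by standard
    (auto simp: scaleR_poly_def poly_eq_iff coeff_map_poly scaleR_add_left scaleR_add_right)

end

lemma scaleR_real_poly: "c *\<^sub>R p = smult c (p :: real poly)"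
  by (simp add: scaleR_poly_def poly_eq_iff coeff_map_poly)

definition scale_fun :: "'a::field \<Rightarrow> (nat \<Rightarrow> 'a) \<Rightarrow> nat \<Rightarrow> 'a" where
  "scale_fun c v = (\<lambda>i. c * v i)"

global_interpretation fun_vs: vector_space scale_fun
  by unfold_locales (auto simp: scale_fun_def fun_eq_iff algebra_simps)

text \<open>
  The space \<open>F\<^sup>n\<close> is modelled inside \<^typ>\<open>nat \<Rightarrow> 'a\<close> by the vectors whose coordinates with index
  at least \<open>n\<close> vanish; this allows an arbitrary \<open>n\<close>, including \<open>n = 0\<close>.
\<close>

definition coord_space :: "nat \<Rightarrow> (nat \<Rightarrow> 'a::field) set" where
  "coord_space n = {v. \<forall>i\<ge>n. v i = 0}"

text \<open>
  The dimension condition is \<open>dim H = n - 1\<close> over the integers: there is no hyperplane for \<open>n = 0\<close>.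
\<close>

definition linear_hyperplane :: "nat \<Rightarrow> (nat \<Rightarrow> 'a::field) set \<Rightarrow> bool" where
  "linear_hyperplane n H \<longleftrightarrow>
     fun_vs.subspace H \<and> H \<subseteq> coord_space n \<and> fun_vs.dim H + 1 = n"

text \<open>Arrangements are lists, so repeated hyperplanes are allowed.\<close>

definition hyperplane_arrangement :: "nat \<Rightarrow> (nat \<Rightarrow> 'a::field) set list \<Rightarrow> bool" where
  "hyperplane_arrangement n Hs \<longleftrightarrow> (\<forall>H\<in>set Hs. linear_hyperplane n H)"

text \<open>
  Intersecting with \<^term>\<open>coord_space n\<close> only affects the empty intersection, which is \<open>F\<^sup>n\<close>.
\<close>

definition characteristic_poly :: "nat \<Rightarrow> (nat \<Rightarrow> 'a::field) set list \<Rightarrow> real poly" where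
  "characteristic_poly n Hs =
     (\<Sum>A\<in>Pow {..<length Hs}.
        (-1) ^ card A * monom 1 (fun_vs.dim (coord_space n \<inter> (\<Inter>i\<in>A. Hs ! i))))"

definition chi :: "nat \<Rightarrow> nat \<Rightarrow> nat \<Rightarrow> real poly" where
  "chi q n k = monom 1 (n - k) * (\<Prod>j<k. [:- (real q ^ j), 1:])"

end

theory Submission
  imports Defs
begin

text \<open>
  Write \<open>Z A\<close> for the intersection of the hyperplanes indexed by \<open>A\<close>.  Newton interpolation at the
  nodes \<open>1, 1/q, 1/q ^ 2, \<dots>\<close> expands \<open>t ^ d\<close> in the polynomials \<open>\<chi> n k\<close>, where the coefficient of
  \<open>\<chi> n k\<close> is a positive multiple of \<open>(-1) ^ k * (\<Prod>j<k. q ^ n - q ^ (d + j))\<close>.  This product counts the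
  independent \<open>k\<close>-tuples whose span meets a given \<open>d\<close>-dimensional subspace trivially.  Hence the
  coordinate of the characteristic polynomial at \<open>\<chi> n k\<close> is a nonnegative combination, over
  \<open>k\<close>-dimensional subspaces \<open>Y\<close>, of \<open>(-1) ^ k\<close> times the sum of \<open>(-1) ^ card A\<close> over all \<open>A\<close> with
  \<open>Y \<inter> Z A = 0\<close>, and this is nonnegative by deletion and restriction.  It vanishes if \<open>Y\<close> lies in one
  of the hyperplanes or meets the intersection of all of them nontrivially; so for the arrangement of
  all hyperplanes containing a fixed subspace of dimension \<open>n - k\<close> only the coordinate at \<open>\<chi> n k\<close>
  survives.
\<close>

section \<open>Counting and dimension formulas over a finite field\<close>

context vector_space
begin

text \<open>A vector \<open>b\<close> outside \<open>span B\<close> multiplies the count by the size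
  of the field, since each element of the larger span is uniquely \<open>c *s b + x\<close> with
  \<open>x\<close> in \<open>span B\<close>.\<close>

lemma card_span_independent:
  assumes "independent B" "finite B"
  shows "card (span B) = CARD('a) ^ card B"
  using assms(2,1)
proof (induction rule: finite_induct)
  case empty
  then show ?case by simp
next
  case (insert b B)
  have b: "b \<notin> span B" and B: "independent B"
    using insert.prems insert.hyps by (simp_all add: independent_insert)
  have img: "span (insert b B) = (\<lambda>(c, x). c *s b + x) ` (UNIV \<times> span B)"
  proof (intro equalityI subsetI)
    fix y assume "y \<in> span (insert b B)"
    then obtain c where "y - c *s b \<in> span B"
      by (auto simp: span_insert)
    then show "y \<in> (\<lambda>(c, x). c *s b + x) ` (UNIV \<times> span B)"
      by (intro image_eqI[of _ _ "(c, y - c *s b)"]) auto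
  next
    fix y assume "y \<in> (\<lambda>(c, x). c *s b + x) ` (UNIV \<times> span B)"
    then obtain c x where "y = c *s b + x" "x \<in> span B"
      by auto
    then show "y \<in> span (insert b B)"
      by (auto simp: span_insert intro!: exI[of _ c])
  qed
  have "inj_on (\<lambda>(c, x). c *s b + x) (UNIV \<times> span B)"
  proof (rule inj_onI, clarify)
    fix c d x y
    assume xy: "x \<in> span B" "y \<in> span B" and eq: "c *s b + x = d *s b + y"
    have *: "(c - d) *s b = y - x"
      using eq by (simp add: scale_left_diff_distrib algebra_simps)
    have "c = d"
    proof (rule ccontr)
      assume "c \<noteq> d"
      then have "b = inverse (c - d) *s (y - x)"
        by (simp flip: *)
      then have "b \<in> span B"
        using xy by (simp add: span_scale span_diff)
      with b show False by contradiction
    qed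
    with eq show "c = d \<and> x = y" by simp
  qed
  then have "card (span (insert b B)) = CARD('a) * card (span B)"
    unfolding img by (simp add: card_image card_cartesian_product)
  then show ?case
    using insert.IH[OF B] insert.hyps by simp
qed

lemma dim_zero [simp]: "dim {0} = 0"
  using dim_span_eq_card_independent[OF independent_empty] by simp

lemma card_subspace:
  assumes "subspace W" "finite W"
  shows "card W = CARD('a) ^ dim W"
proof -
  obtain B where B: "B \<subseteq> W" "independent B" "W \<subseteq> span B" "card B = dim W"
    by (rule basis_exists)
  have "span B = W"
    using B assms(1) by (intro span_subspace)
  moreover have "finite B" using B(1) assms(2) by (rule finite_subset)
  ultimately show ?thesis
    using card_span_independent[of B] B by simp
qed

text \<open>Once one decomposition \<open>z = f z + (z - f z)\<close> is fixed for each
  \<open>z\<close> in the sum, all others arise by moving an element of \<open>S \<inter> T\<close>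
  from one summand to the other.\<close>

lemma card_sums_Int:
  assumes "subspace S" "subspace T"
  shows "card {x + y |x y. x \<in> S \<and> y \<in> T} * card (S \<inter> T) = card S * card T"
proof -
  define ST where "ST = {x + y |x y. x \<in> S \<and> y \<in> T}"
  have "\<exists>f. \<forall>z\<in>ST. f z \<in> S \<and> z - f z \<in> T"
  proof (rule bchoice, rule ballI)
    fix z assume "z \<in> ST"
    then obtain x y where "z = x + y" "x \<in> S" "y \<in> T" unfolding ST_def by blast
    then have "x \<in> S \<and> z - x \<in> T" by simp
    then show "\<exists>x. x \<in> S \<and> z - x \<in> T" by blast
  qed
  then obtain f where f: "\<And>z. z \<in> ST \<Longrightarrow> f z \<in> S" "\<And>z. z \<in> ST \<Longrightarrow> z - f z \<in> T"
    by blast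
  have "bij_betw (\<lambda>(z, w). (f z + w, z - f z - w)) (ST \<times> (S \<inter> T)) (S \<times> T)"
  proof (rule bij_betw_byWitness[where f' = "\<lambda>(x, y). (x + y, x - f (x + y))"])
    show "(\<lambda>(z, w). (f z + w, z - f z - w)) ` (ST \<times> (S \<inter> T)) \<subseteq> S \<times> T"
      using f assms by (auto intro: subspace_add subspace_diff)
    have "x + y \<in> ST \<and> x - f (x + y) \<in> S \<inter> T" if xy: "x \<in> S" "y \<in> T" for x y
    proof -
      have z: "x + y \<in> ST" using xy unfolding ST_def by blast
      have "x - f (x + y) \<in> T"
        using subspace_diff[OF assms(2) f(2)[OF z] xy(2)] by (simp add: algebra_simps)
      then show ?thesis
        using z subspace_diff[OF assms(1) xy(1) f(1)[OF z]] by simp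
    qed
    then show "(\<lambda>(x, y). (x + y, x - f (x + y))) ` (S \<times> T) \<subseteq> ST \<times> (S \<inter> T)"
      by auto
  qed (auto simp: algebra_simps)
  from bij_betw_same_card[OF this] show ?thesis
    by (simp only: card_cartesian_product ST_def)
qed

lemma card_field_gt_1:
  assumes "finite (UNIV :: 'a set)"
  shows "CARD('a) > 1"
proof -
  have "card {0 :: 'a, 1} \<le> CARD('a)"
    using assms by (intro card_mono) auto
  then show ?thesis by simp
qed

lemma finite_sums: "finite S \<Longrightarrow> finite T \<Longrightarrow> finite {x + y |x y. x \<in> S \<and> y \<in> T}"
  by (rule finite_subset[of _ "(\<lambda>(x, y). x + y) ` (S \<times> T)"]) auto

text \<open>This is the counting identity \<open>card_sums_Int\<close> with both sides written as
  powers of the field size, whose exponents are then compared.\<close>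

lemma dim_sums_Int_finite:
  assumes "subspace S" "subspace T" "finite S" "finite T" "finite (UNIV :: 'a set)"
  shows "dim {x + y |x y. x \<in> S \<and> y \<in> T} + dim (S \<inter> T) = dim S + dim T"
proof -
  have "CARD('a) ^ (dim {x + y |x y. x \<in> S \<and> y \<in> T} + dim (S \<inter> T)) = CARD('a) ^ (dim S + dim T)"
    using card_sums_Int[OF assms(1,2)] assms
    by (simp add: power_add subspace_sums subspace_inter finite_sums flip: card_subspace)
  then show ?thesis
    using card_field_gt_1[OF assms(5)] power_inject_exp by blast
qed

lemma dim_subset_finite:
  assumes "subspace S" "subspace T" "finite T" "finite (UNIV :: 'a set)" "S \<subseteq> T"
  shows "dim S \<le> dim T"
proof -
  have "card S \<le> card T" "finite S"
    using assms by (auto intro: card_mono finite_subset)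
  then show ?thesis
    using card_field_gt_1[OF assms(4)] assms by (simp add: card_subspace)
qed

lemma subspace_eq_if_dim_le:
  assumes "subspace S" "subspace T" "finite T" "S \<subseteq> T" "dim T \<le> dim S" "finite (UNIV :: 'a set)"
  shows "S = T"
proof (rule card_subset_eq[OF assms(3,4)])
  have "finite S" using assms finite_subset by blast
  moreover have "dim S = dim T"
    using dim_subset_finite[OF assms(1-3,6,4)] assms(5) by simp
  ultimately show "card S = card T"
    using assms by (simp add: card_subspace)
qed

lemma dim_span_insert_finite:
  assumes "subspace Y" "finite Y" "v \<notin> Y"
  shows "dim (span (insert v Y)) = dim Y + 1"
proof -
  obtain B where B: "B \<subseteq> Y" "independent B" "Y \<subseteq> span B" "card B = dim Y"
    by (rule basis_exists)
  have Y: "span B = Y"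
    using B assms(1) by (intro span_subspace)
  have fB: "finite B" using B assms finite_subset by blast
  have "independent (insert v B)"
    using assms(3) B Y by (simp add: independent_insertI)
  moreover have "v \<notin> B" using B assms(3) by auto
  moreover have "span (insert v B) = span (insert v Y)"
    by (simp add: span_insert Y span_eq_iff[THEN iffD2, OF assms(1)])
  ultimately show ?thesis
    using B(4) fB dim_span_eq_card_independent[of "insert v B"] by simp
qed

text \<open>A nonzero \<open>z\<close> in \<open>Z\<close> of the form \<open>y + c *s v\<close>
  either lies in \<open>Y\<close> (if \<open>c = 0\<close>) or can be solved for \<open>v\<close>,
  which puts \<open>v\<close> into \<open>Y + Z\<close>.\<close>

lemma span_insert_Int_eq_0_iff:
  assumes "subspace Y" "subspace Z" "v \<notin> Y"
  shows "span (insert v Y) \<inter> Z = {0} \<longleftrightarrow> Y \<inter> Z = {0} \<and> v \<notin> {x + y |x y. x \<in> Y \<and> y \<in> Z}"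
proof (intro iffI conjI)
  assume *: "span (insert v Y) \<inter> Z = {0}"
  have "Y \<subseteq> span (insert v Y)" using span_superset by blast
  then show "Y \<inter> Z = {0}" using * subspace_0[OF assms(1)] subspace_0[OF assms(2)] by blast
  show "v \<notin> {x + y |x y. x \<in> Y \<and> y \<in> Z}"
  proof
    assume "v \<in> {x + y |x y. x \<in> Y \<and> y \<in> Z}"
    then obtain x y where v: "v = x + y" "x \<in> Y" "y \<in> Z" by auto
    have "v - x \<in> span (insert v Y)"
      using v by (intro span_diff span_base) auto
    with * v have "y = 0" by auto
    with v assms show False by simp
  qed
next
  assume *: "Y \<inter> Z = {0} \<and> v \<notin> {x + y |x y. x \<in> Y \<and> y \<in> Z}"
  have "z = 0" if z: "z \<in> span (insert v Y)" "z \<in> Z" for z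
  proof -
    have "span Y = Y" using assms(1) by (simp only: span_eq_iff)
    then have "\<exists>c. z - c *s v \<in> Y"
      using z(1) by (simp only: span_insert mem_Collect_eq)
    then obtain c where c: "z - c *s v \<in> Y" ..
    show ?thesis
    proof (cases "c = 0")
      case True
      then show ?thesis using c * z by auto
    next
      case False
      have "v = inverse c *s (- (z - c *s v)) + inverse c *s z"
        using False by (simp add: scale_right_diff_distrib)
      moreover have "inverse c *s (- (z - c *s v)) \<in> Y" "inverse c *s z \<in> Z"
        using c z assms by (auto intro: subspace_scale subspace_neg simp del: minus_diff_eq)
      ultimately show ?thesis using * by blast
    qed
  qed
  moreover have "0 \<in> span (insert v Y) \<inter> Z"
    using assms by (simp add: span_zero subspace_0)
  ultimately show "span (insert v Y) \<inter> Z = {0}" by blast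
qed

lemma ex_subspace_dim:
  assumes "subspace V" "finite V" "k \<le> dim V"
  obtains W where "subspace W" "W \<subseteq> V" "dim W = k"
proof -
  obtain B where B: "B \<subseteq> V" "independent B" "V \<subseteq> span B" "card B = dim V"
    by (rule basis_exists)
  obtain C where C: "C \<subseteq> B" "card C = k"
    using obtain_subset_with_card_n[of k B] B(4) assms(3) by auto
  show thesis
  proof
    show "subspace (span C)" by simp
    show "span C \<subseteq> V"
      using B C assms by (intro span_minimal) auto
    show "dim (span C) = k"
      using dim_span_eq_card_independent[OF independent_mono[OF B(2) C(1)]] C by simp
  qed
qed

text \<open>Extend a basis of \<open>U\<close> to one of \<open>V\<close> and drop one of the added
  vectors.\<close>

lemma ex_hyperplane_superspace:
  assumes "subspace U" "subspace V" "U \<subseteq> V" "U \<noteq> V" "finite V"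
  obtains H where "subspace H" "U \<subseteq> H" "H \<subseteq> V" "dim H + 1 = dim V"
proof -
  obtain B where B: "B \<subseteq> U" "independent B" "U \<subseteq> span B"
    by (rule basis_exists)
  obtain C where C: "B \<subseteq> C" "C \<subseteq> V" "independent C" "V \<subseteq> span C"
    using maximal_independent_subset_extend[OF subset_trans[OF B(1) assms(3)] B(2)] by blast
  have V: "span C = V"
    using C assms by (intro span_subspace)
  have "B \<noteq> C"
  proof
    assume "B = C"
    with B(3) C(4) V have "V \<subseteq> span U" using span_mono[OF B(1)] by blast
    with assms show False by (simp add: span_eq_iff[THEN iffD2])
  qed
  then obtain c where c: "c \<in> C" "c \<notin> B" using C by auto
  have fC: "finite C" using C assms finite_subset by blast
  show thesis
  proof
    show "subspace (span (C - {c}))" by simp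
    show "U \<subseteq> span (C - {c})"
      using B(3) span_mono[of B "C - {c}"] C(1) c(2) by blast
    show "span (C - {c}) \<subseteq> V"
      using V span_mono[of "C - {c}" C] by auto
    have "dim (span (C - {c})) = card C - 1"
      using dim_span_eq_card_independent[OF independent_mono[OF C(3)], of "C - {c}"] c fC by simp
    moreover have "dim V = card C" using dim_span_eq_card_independent[OF C(3)] V by simp
    moreover have "card C > 0" using c fC card_gt_0_iff by blast
    ultimately show "dim (span (C - {c})) + 1 = dim V" by simp
  qed
qed

end

section \<open>Alternating sums over a family of hyperplanes\<close>

locale hyperplane_family = vector_space scale
  for scale :: "'a::field \<Rightarrow> 'b::ab_group_add \<Rightarrow> 'b" +
  fixes V :: "'b set" and J :: "'i set" and H :: "'i \<Rightarrow> 'b set" and q :: real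
  assumes q_eq: "q = real CARD('a)" and finite_field: "finite (UNIV :: 'a set)"
    and subspace_V: "subspace V" and finite_V: "finite V" and finite_J: "finite J"
    and subspace_H: "j \<in> J \<Longrightarrow> subspace (H j)"
    and H_subset: "j \<in> J \<Longrightarrow> H j \<subseteq> V"
    and dim_H: "j \<in> J \<Longrightarrow> dim (H j) + 1 = dim V"
begin

definition flat :: "'i set \<Rightarrow> 'b set" where
  "flat A = V \<inter> (\<Inter>i\<in>A. H i)"

text \<open>For a subspace \<open>Y\<close> of \<open>V\<close> this is the alternating sum of
  \<open>t ^ dim (Y \<inter> flat A)\<close> at \<open>t = 0\<close>, that is, the constant term of
  the characteristic polynomial of the family restricted to \<open>Y\<close>.\<close>

definition avoid :: "'i set \<Rightarrow> 'b set \<Rightarrow> real" where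
  "avoid I Y = (\<Sum>A\<in>Pow I. (-1) ^ card A * of_bool (Y \<inter> flat A = {0}))"

text \<open>When \<open>Y\<close> meets \<open>flat A\<close> trivially, the product counts the
  ordered \<open>k\<close>-tuples in \<open>V\<close> that are independent modulo
  \<open>Y + flat A\<close>.\<close>

definition wavoid :: "nat \<Rightarrow> 'b set \<Rightarrow> real" where
  "wavoid k Y = (\<Sum>A\<in>Pow J. (-1) ^ card A *
     (of_bool (Y \<inter> flat A = {0}) * (\<Prod>j<k. q ^ dim V - q ^ (dim (flat A) + dim Y + j))))"

lemma q_gt_1: "q > 1"
  using card_field_gt_1[OF finite_field] by (simp add: q_eq)

lemma subspace_flat: "A \<subseteq> J \<Longrightarrow> subspace (flat A)"
  unfolding flat_def using subspace_V subspace_H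
  by (intro subspace_inter subspace_Inter) auto

lemma flat_subset: "flat A \<subseteq> V"
  by (auto simp: flat_def)

lemma flat_empty: "flat {} = V"
  by (simp add: flat_def)

text \<open>The sum \<open>Y + H j\<close> properly contains the hyperplane \<open>H j\<close>, so
  it has the dimension of \<open>V\<close>; the dimension formula does the rest.\<close>

lemma dim_Int_H:
  assumes "subspace Y" "Y \<subseteq> V" "j \<in> J" "\<not> Y \<subseteq> H j"
  shows "dim (Y \<inter> H j) + 1 = dim Y"
proof -
  have fin: "finite Y" "finite (H j)"
    using assms H_subset finite_V finite_subset by metis+
  let ?S = "{x + y |x y. x \<in> Y \<and> y \<in> H j}"
  have S: "subspace ?S"
    using assms subspace_H by (intro subspace_sums) auto
  have "?S \<subseteq> V"
    using assms H_subset subspace_V by (auto intro!: subspace_add)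
  then have le: "dim ?S \<le> dim V"
    using S subspace_V finite_V finite_field dim_subset_finite by simp
  have HS: "H j \<subseteq> ?S"
    using subspace_0[OF assms(1)] by force
  have YS: "Y \<subseteq> ?S"
    using subspace_0[OF subspace_H[OF assms(3)]] by force
  have "H j \<noteq> ?S" using YS assms(4) by auto
  then have "\<not> dim ?S \<le> dim (H j)"
    using subspace_eq_if_dim_le[OF subspace_H[OF assms(3)] S finite_sums[OF fin] HS _ finite_field]
    by blast
  then have "dim ?S = dim V"
    using le dim_H[OF assms(3)] by simp
  then show ?thesis
    using dim_sums_Int_finite[of Y "H j"] assms fin finite_field subspace_H dim_H[OF assms(3)] by simp
qed

text \<open>Deletion and restriction: the subsets without \<open>j\<close> give the first term;
  those with \<open>j\<close> change sign and cut \<open>Y\<close> down to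
  \<open>Y \<inter> H j\<close>.\<close>

lemma avoid_insert:
  assumes "finite I" "j \<notin> I"
  shows "avoid (insert j I) Y = avoid I Y - avoid I (Y \<inter> H j)"
proof -
  have inj: "inj_on (insert j) (Pow I)"
    using assms by (intro inj_onI) (auto simp: subset_iff)
  have "avoid (insert j I) Y = avoid I Y +
      (\<Sum>A\<in>insert j ` Pow I. (-1) ^ card A * of_bool (Y \<inter> flat A = {0}))"
    unfolding avoid_def Pow_insert using assms
    by (intro sum.union_disjoint) auto
  also have "(\<Sum>A\<in>insert j ` Pow I. (-1) ^ card A * of_bool (Y \<inter> flat A = {0})) =
      (\<Sum>A\<in>Pow I. (-1 :: real) ^ card (insert j A) * of_bool (Y \<inter> flat (insert j A) = {0}))"
    using sum.reindex[OF inj] by (simp add: o_def)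
  also have "\<dots> = (\<Sum>A\<in>Pow I. - ((-1) ^ card A * of_bool (Y \<inter> H j \<inter> flat A = {0})))"
  proof (rule sum.cong[OF refl])
    fix A assume A: "A \<in> Pow I"
    have "finite A" "j \<notin> A" using A assms finite_subset by auto
    moreover have "Y \<inter> flat (insert j A) = Y \<inter> H j \<inter> flat A"
      by (auto simp: flat_def)
    ultimately show "(-1 :: real) ^ card (insert j A) * of_bool (Y \<inter> flat (insert j A) = {0}) =
      - ((-1) ^ card A * of_bool (Y \<inter> H j \<inter> flat A = {0}))" by simp
  qed
  finally show ?thesis
    by (simp add: avoid_def sum_negf)
qed

text \<open>Restricting to \<open>H j\<close> does not change \<open>Y\<close>, so the two terms of
  deletion and restriction for \<open>j\<close> cancel.\<close>

lemma avoid_eq_0: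
  assumes "finite I" "j \<in> I" "Y \<subseteq> H j"
  shows "avoid I Y = 0"
proof -
  have "Y \<inter> H j = Y" using assms by auto
  then show ?thesis
    using avoid_insert[of "I - {j}" j Y] assms by (simp add: insert_absorb)
qed

text \<open>Restriction to a hyperplane not containing \<open>Y\<close> lowers the dimension by one,
  and this sign change compensates the minus sign in \<open>avoid_insert\<close>.\<close>

lemma avoid_sign:
  assumes "I \<subseteq> J" "subspace Y" "Y \<subseteq> V"
  shows "(-1) ^ dim Y * avoid I Y \<ge> 0"
proof -
  have "finite I" using assms finite_J finite_subset by blast
  then show ?thesis using assms
  proof (induction I arbitrary: Y rule: finite_induct)
    case empty
    then have "Y \<inter> V = Y" by blast
    then show ?case by (cases "Y = {0}") (simp_all add: avoid_def flat_empty)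
  next
    case (insert j I)
    show ?case
    proof (cases "Y \<subseteq> H j")
      case True
      then show ?thesis using avoid_eq_0[of "insert j I" j Y] insert by simp
    next
      case False
      have d: "dim Y = Suc (dim (Y \<inter> H j))"
        using dim_Int_H[of Y j] False insert.prems by simp
      have "(-1) ^ dim Y * avoid I Y \<ge> 0"
        using insert by simp
      moreover have "(-1) ^ dim (Y \<inter> H j) * avoid I (Y \<inter> H j) \<ge> 0"
        using insert subspace_H[of j] by (intro insert.IH) (auto intro: subspace_inter)
      ultimately show ?thesis
        unfolding avoid_insert[OF insert.hyps] d by (simp add: algebra_simps)
    qed
  qed
qed

text \<open>For \<open>Y \<inter> Z = 0\<close>, a vector \<open>v\<close> keeps \<open>(Y + \<langle>v\<rangle>) \<inter> Z = 0\<close> iff \<open>v \<notin> Y + Z\<close>, and there are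
  \<open>q ^ dim V - q ^ (dim Y + dim Z)\<close> such vectors in \<open>V\<close>.\<close>

lemma wavoid_Suc:
  assumes "subspace Y" "Y \<subseteq> V"
  shows "wavoid (Suc k) Y = (\<Sum>v\<in>V - Y. wavoid k (span (insert v Y)))"
proof -
  have fY: "finite Y" using assms finite_V finite_subset by blast
  \<comment> \<open>These are the factors of the weight after the first one. The first factor will
    come from counting \<open>v\<close>; passing to \<open>span (insert v Y)\<close> raises the
    dimension by one and so shifts the others to \<open>Suc j\<close>.\<close>
  define P where "P A = (\<Prod>j<k. q ^ dim V - q ^ (dim (flat A) + dim Y + Suc j))" for A
  define b where "b A v = (of_bool (span (insert v Y) \<inter> flat A = {0}) :: real)" for A v
  have "(\<Sum>v\<in>V - Y. wavoid k (span (insert v Y))) =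
      (\<Sum>v\<in>V - Y. \<Sum>A\<in>Pow J. (-1) ^ card A * (b A v * P A))"
    unfolding wavoid_def P_def b_def
    by (intro sum.cong refl) (simp add: dim_span_insert_finite[OF assms(1) fY] del: dim_span)
  also have "\<dots> = (\<Sum>A\<in>Pow J. (-1) ^ card A * ((\<Sum>v\<in>V - Y. b A v) * P A))"
    by (subst sum.swap) (simp add: sum_distrib_left sum_distrib_right mult.assoc)
  also have "\<dots> = wavoid (Suc k) Y"
    unfolding wavoid_def
  proof (rule sum.cong[OF refl])
    fix A assume "A \<in> Pow J"
    then have Z: "subspace (flat A)" "flat A \<subseteq> V" "finite (flat A)"
      using subspace_flat flat_subset finite_subset[OF flat_subset finite_V] by auto
    let ?S = "{x + y |x y. x \<in> Y \<and> y \<in> flat A}"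
    have S: "subspace ?S" "finite ?S" "?S \<subseteq> V" "Y \<subseteq> ?S"
      using assms Z fY subspace_0[OF Z(1)] subspace_V
      by (force intro!: subspace_sums finite_sums subspace_add)+
    have "(\<Sum>v\<in>V - Y. b A v) = of_bool (Y \<inter> flat A = {0}) * (q ^ dim V - q ^ (dim (flat A) + dim Y))"
    proof (cases "Y \<inter> flat A = {0}")
      case True
      have "(\<Sum>v\<in>V - Y. b A v) = (\<Sum>v\<in>V - Y. of_bool (v \<notin> ?S))"
        unfolding b_def using True span_insert_Int_eq_0_iff[OF assms(1) Z(1)]
        by (intro sum.cong refl) auto
      also have "\<dots> = real (card (V - ?S))"
      proof -
        have "(V - Y) \<inter> {v. v \<notin> ?S} = V - ?S" using S by auto
        then show ?thesis using finite_V by simp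
      qed
      also have "\<dots> = real (card V) - real (card ?S)"
        using S finite_V by (simp add: card_Diff_subset card_mono of_nat_diff)
      also have "real (card ?S) = q ^ (dim (flat A) + dim Y)"
        using dim_sums_Int_finite[OF assms(1) Z(1) fY Z(3) finite_field] True S
        by (simp add: q_eq card_subspace add.commute)
      finally show ?thesis
        using True by (simp add: q_eq card_subspace subspace_V finite_V)
    next
      case False
      then show ?thesis
        unfolding b_def using span_insert_Int_eq_0_iff[OF assms(1) Z(1)]
        by (auto intro!: sum.neutral)
    qed
    then show "(-1) ^ card A * ((\<Sum>v\<in>V - Y. b A v) * P A) = (-1) ^ card A *
        (of_bool (Y \<inter> flat A = {0}) * (\<Prod>j<Suc k. q ^ dim V - q ^ (dim (flat A) + dim Y + j)))"
      by (simp add: P_def prod.lessThan_Suc_shift del: prod.lessThan_Suc)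
  qed
  finally show ?thesis ..
qed

text \<open>Iterating \<open>wavoid_Suc\<close> turns \<open>wavoid k Y\<close> into a sum of values
  \<open>avoid J Y'\<close> with \<open>dim Y' = dim Y + k\<close>. The factor \<open>c\<close>
  allows one statement to yield both the sign (\<open>c = (-1) ^ k\<close>) and the vanishing
  (\<open>c = 1\<close> and \<open>c = -1\<close>).\<close>

lemma wavoid_sign:
  assumes "subspace Y" "Y \<subseteq> V"
    and "\<And>Y'. subspace Y' \<Longrightarrow> Y' \<subseteq> V \<Longrightarrow> dim Y' = dim Y + k \<Longrightarrow> 0 \<le> c * avoid J Y'"
  shows "0 \<le> c * wavoid k Y"
  using assms
proof (induction k arbitrary: Y)
  case 0
  then show ?case by (simp add: wavoid_def avoid_def)
next
  case (Suc k)
  have fY: "finite Y" using Suc.prems finite_V finite_subset by blast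
  have "0 \<le> c * wavoid k (span (insert v Y))" if v: "v \<in> V - Y" for v
  proof (rule Suc.IH)
    show "span (insert v Y) \<subseteq> V"
      using v Suc.prems subspace_V by (intro span_minimal) auto
    have "dim (span (insert v Y)) = dim Y + 1"
      using v dim_span_insert_finite[OF Suc.prems(1) fY] by simp
    then show "0 \<le> c * avoid J Y'" 
      if "subspace Y'" "Y' \<subseteq> V" "dim Y' = dim (span (insert v Y)) + k" for Y'
      using that by (intro Suc.prems(3)) simp_all
  qed simp
  then show ?case
    unfolding wavoid_Suc[OF Suc.prems(1,2)] sum_distrib_left by (rule sum_nonneg)
qed

end

section \<open>Newton expansion of monomials in the polynomials \<open>chi\<close>\<close>

text \<open>For \<open>x = 1 / q ^ m\<close> this is the coefficient of \<open>s ^ m\<close> at the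
  Newton basis element \<open>(\<Prod>j<k. 1 - q ^ j * s)\<close>. Keeping \<open>x\<close> as a
  real variable makes raising \<open>m\<close> the substitution of \<open>x / q\<close> for
  \<open>x\<close>.\<close>

definition newton_coeff :: "real \<Rightarrow> real \<Rightarrow> nat \<Rightarrow> real" where
  "newton_coeff q x k = (\<Prod>j<k. q * (x * q ^ j - 1) / (q ^ Suc j - 1))"

lemma newton_coeff_Suc:
  "newton_coeff q x (Suc k) = newton_coeff q x k * (q * (x * q ^ k - 1) / (q ^ Suc k - 1))"
  by (simp add: newton_coeff_def)

text \<open>Replacing \<open>x\<close> by \<open>x / q\<close> shifts the numerators by one index,
  so only a new first numerator \<open>x - q\<close> and the last denominator remain.\<close>

lemma newton_coeff_divide:
  assumes "q > 1"
  shows "newton_coeff q (x / q) (Suc k) = newton_coeff q x k * (x - q) / (q ^ Suc k - 1)"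
proof (induction k)
  case 0
  then show ?case using assms by (simp add: newton_coeff_def field_simps)
next
  case (Suc k)
  have "newton_coeff q (x / q) (Suc (Suc k)) =
      newton_coeff q (x / q) (Suc k) * (q * (x / q * q ^ Suc k - 1) / (q ^ Suc (Suc k) - 1))"
    by (rule newton_coeff_Suc)
  also have "x / q * q ^ Suc k = x * q ^ k" using assms by simp
  finally show ?case
    unfolding Suc newton_coeff_Suc[of q x k] by (simp only: times_divide_eq_left times_divide_eq_right mult_ac)
qed

lemma newton_coeff_divide':
  assumes "q > 1"
  shows "newton_coeff q (x / q) (Suc k) =
    newton_coeff q x (Suc k) / q ^ Suc k - newton_coeff q x k / q ^ k"
proof -
  have *: "q ^ Suc k > 1" using assms by (rule one_less_power) simp
  show ?thesis
    unfolding newton_coeff_divide[OF assms] newton_coeff_Suc[of q x k] using * assms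
    by (simp add: field_simps)
qed

text \<open>The new factor is \<open>t - q ^ k\<close>, and \<open>t\<close> times
  \<open>chi q n k\<close> is \<open>chi q (Suc n) k\<close>. Read backwards, it rewrites
  \<open>chi q n k\<close> at level \<open>Suc n\<close>.\<close>

lemma chi_Suc_Suc:
  assumes "k \<le> n"
  shows "chi q (Suc n) (Suc k) = chi q (Suc n) k - smult (real q ^ k) (chi q n k)"
  using assms by (simp add: chi_def Suc_diff_le monom_Suc algebra_simps)

text \<open>Dividing by \<open>t ^ n\<close> and putting \<open>s = 1 / t\<close>, this is Newton interpolation of the powers of \<open>s\<close>
  at the nodes \<open>1, 1/q, 1/q\<^sup>2, \<dots>\<close>.\<close>

lemma monom_eq_sum_chi:
  assumes "d \<le> n" "q > 1"
  shows "monom 1 d = (\<Sum>k\<le>n. newton_coeff q (real q ^ d / real q ^ n) k *\<^sub>R chi q n k)"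
  using assms(1)
proof (induction n)
  case 0
  then show ?case by (simp add: newton_coeff_def chi_def)
next
  case (Suc n)
  show ?case
  proof (cases "d = Suc n")
    case True
    \<comment> \<open>Here \<open>x = 1\<close>, so the factor with \<open>j = 0\<close> vanishes
      and only \<open>t ^ Suc n\<close> itself survives.\<close>
    have "newton_coeff q 1 k = 0" if "k > 0" for k
      unfolding newton_coeff_def using that by (intro prod_zero bexI[of _ 0]) auto
    then have "(\<Sum>k\<le>Suc n. newton_coeff q 1 k *\<^sub>R chi q (Suc n) k) =
        (\<Sum>k\<in>{0}. newton_coeff q 1 k *\<^sub>R chi q (Suc n) k)"
      by (intro sum.mono_neutral_right) auto
    then show ?thesis
      using True assms(2) by (simp add: newton_coeff_def chi_def)
  next
    case False
    then have d: "d \<le> n" using Suc.prems by simp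
    define x where "x = real q ^ d / real q ^ n"
    define B where "B k = newton_coeff q x k / real q ^ k" for k
    \<comment> \<open>The factor with \<open>j = n - d\<close> is zero because
      \<open>x * q ^ (n - d) = 1\<close>. Hence the sum over \<open>B\<close> may be extended to
      \<open>Suc n\<close>, as the summation by parts below requires.\<close>
    have "newton_coeff q x (Suc n) = 0"
      unfolding newton_coeff_def x_def using d assms(2)
      by (intro prod_zero bexI[of _ "n - d"]) (auto simp flip: power_add)
    then have B0: "B (Suc n) = 0" by (simp add: B_def)
    have "newton_coeff q x k *\<^sub>R chi q n k = B k *\<^sub>R chi q (Suc n) k - B k *\<^sub>R chi q (Suc n) (Suc k)"
      if "k \<le> n" for k
      using that assms(2) by (simp add: chi_Suc_Suc B_def scaleR_real_poly smult_diff_right)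
    then have "monom 1 d = (\<Sum>k\<le>n. B k *\<^sub>R chi q (Suc n) k) - (\<Sum>k\<le>n. B k *\<^sub>R chi q (Suc n) (Suc k))"
      using Suc.IH[OF d] by (simp add: sum_subtractf x_def)
    also have "(\<Sum>k\<le>n. B k *\<^sub>R chi q (Suc n) k) = (\<Sum>k\<le>Suc n. B k *\<^sub>R chi q (Suc n) k)"
      using B0 by simp
    also have "\<dots> = B 0 *\<^sub>R chi q (Suc n) 0 + (\<Sum>k\<le>n. B (Suc k) *\<^sub>R chi q (Suc n) (Suc k))"
      by (rule sum.atMost_Suc_shift)
    also have "\<dots> - (\<Sum>k\<le>n. B k *\<^sub>R chi q (Suc n) (Suc k)) =
        B 0 *\<^sub>R chi q (Suc n) 0 + (\<Sum>k\<le>n. (B (Suc k) - B k) *\<^sub>R chi q (Suc n) (Suc k))"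
      by (simp add: sum_subtractf scaleR_diff_left)
    also have "\<dots> = newton_coeff q (x / q) 0 *\<^sub>R chi q (Suc n) 0 +
        (\<Sum>k\<le>n. newton_coeff q (x / q) (Suc k) *\<^sub>R chi q (Suc n) (Suc k))"
      using newton_coeff_divide'[of q x] assms(2) by (simp add: B_def newton_coeff_def)
    also have "\<dots> = (\<Sum>k\<le>Suc n. newton_coeff q (x / q) k *\<^sub>R chi q (Suc n) k)"
      by (rule sum.atMost_Suc_shift[symmetric])
    finally show ?thesis by (simp add: x_def field_simps)
  qed
qed

section \<open>Linear and affine independence of the polynomials \<open>chi\<close>\<close>

lemma coeff_chi_eq_0: "i < n - k \<Longrightarrow> coeff (chi q n k) i = 0"
  by (simp add: chi_def coeff_monom_mult)

text \<open>This coefficient is the product of the linear factors at \<open>t = 0\<close>, and each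
  of them is \<open>- (q ^ j)\<close>.\<close>

lemma coeff_chi_low:
  assumes "q > 0"
  shows "coeff (chi q n k) (n - k) \<noteq> 0"
  using assms by (simp add: chi_def coeff_monom_mult flip: poly_0_coeff_0) (simp add: poly_prod)

lemma coeff_chi_top:
  assumes "k \<le> n"
  shows "coeff (chi q n k) n = 1"
proof -
  let ?P = "\<Prod>j<k. [:- (real q ^ j), 1:]"
  have "degree ?P = k" by (subst degree_prod_eq_sum_degree) auto
  moreover have "lead_coeff ?P = 1" by (simp add: lead_coeff_prod)
  ultimately show ?thesis
    using assms by (simp add: chi_def coeff_monom_mult)
qed

lemma sum_chi_eq_0D:
  assumes "(\<Sum>k\<le>n. u k *\<^sub>R chi q n k) = 0" "q > 0" "k \<le> n"
  shows "u k = 0"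
proof (rule ccontr)
  assume "u k \<noteq> 0"
  \<comment> \<open>The lowest power in \<open>chi q n k\<close> is \<open>t ^ (n - k)\<close>. So
    at \<open>t ^ (n - K)\<close>, for the largest index \<open>K\<close> with nonzero coefficient,
    the smaller indices contribute nothing.\<close>
  define K where "K = Max {k. k \<le> n \<and> u k \<noteq> 0}"
  have "K \<in> {k. k \<le> n \<and> u k \<noteq> 0}"
    unfolding K_def using assms \<open>u k \<noteq> 0\<close> by (intro Max_in) auto
  then have K: "K \<le> n" "u K \<noteq> 0" by auto
  have max: "u j = 0" if "j \<le> n" "j > K" for j
  proof (rule ccontr)
    assume "u j \<noteq> 0"
    then have "j \<le> K" unfolding K_def using that by (intro Max_ge) auto
    with that show False by simp
  qed
  have "0 = coeff (\<Sum>k\<le>n. u k *\<^sub>R chi q n k) (n - K)"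
    using assms by simp
  also have "\<dots> = (\<Sum>j\<le>n. u j * coeff (chi q n j) (n - K))"
    by (simp add: coeff_sum scaleR_real_poly)
  also have "\<dots> = (\<Sum>j\<in>{K}. u j * coeff (chi q n j) (n - K))"
  proof (rule sum.mono_neutral_right)
    show "\<forall>j\<in>{..n} - {K}. u j * coeff (chi q n j) (n - K) = 0"
    proof
      fix j assume j: "j \<in> {..n} - {K}"
      then consider "j > K" | "n - K < n - j" using K by force
      then show "u j * coeff (chi q n j) (n - K) = 0"
        using j max by cases (auto simp: coeff_chi_eq_0)
    qed
  qed (use K in auto)
  finally show False
    using K coeff_chi_low[OF assms(2)] by simp
qed

lemma inj_chi:
  assumes "q > 0"
  shows "inj_on (chi q n) {..n}"
proof -
  have "i = j" if ij: "i \<le> n" "j \<le> n" "chi q n i = chi q n j" for i j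
  proof (rule ccontr)
    assume "i \<noteq> j"
    then consider "n - i < n - j" | "n - j < n - i" using ij by linarith
    then show False
      using coeff_chi_eq_0[of "n - i" n j q] coeff_chi_eq_0[of "n - j" n i q] ij(3)
        coeff_chi_low[OF assms, of n i] coeff_chi_low[OF assms, of n j] by cases auto
  qed
  then show ?thesis by (auto intro: inj_onI)
qed

lemma affine_independent_chi:
  assumes "q > 0"
  shows "\<not> affine_dependent (chi q n ` {..n})"
proof
  assume "affine_dependent (chi q n ` {..n})"
  then have "dependent (chi q n ` {..n})" by (rule affine_dependent_imp_dependent)
  then obtain u v where u: "(\<Sum>v\<in>chi q n ` {..n}. u v *\<^sub>R v) = 0"
      "v \<in> chi q n ` {..n}" "u v \<noteq> 0"
    using real_vector.dependent_finite[of "chi q n ` {..n}"] by auto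
  have "(\<Sum>k\<le>n. u (chi q n k) *\<^sub>R chi q n k) = 0"
    using u(1) by (simp add: sum.reindex[OF inj_chi[OF assms]])
  then show False
    using sum_chi_eq_0D[where n = n and q = q and u = "\<lambda>k. u (chi q n k)"] u assms by auto
qed

section \<open>The coordinate space over a finite field\<close>

lemma subspace_coord_space: "fun_vs.subspace (coord_space n)"
  by (auto simp: fun_vs.subspace_def coord_space_def scale_fun_def)

lemma card_coord_space:
  "card (coord_space n :: (nat \<Rightarrow> 'a::{field,finite}) set) = CARD('a) ^ n"
proof -
  have "bij_betw (\<lambda>v. restrict v {..<n}) (coord_space n) ({..<n} \<rightarrow>\<^sub>E (UNIV :: 'a set))"
    by (rule bij_betw_byWitness[where f' = "\<lambda>f i. if i < n then f i else 0"])
      (auto simp: coord_space_def fun_eq_iff restrict_def PiE_def extensional_def)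
  then show ?thesis
    by (metis bij_betw_same_card card_funcsetE card_lessThan finite_lessThan)
qed

lemma finite_coord_space: "finite (coord_space n :: (nat \<Rightarrow> 'a::{field,finite}) set)"
  using card_coord_space[of n, where 'a = 'a] by (metis card.infinite finite zero_less_card_finite power_not_zero less_numeral_extra(3))

lemma dim_coord_space: "fun_vs.dim (coord_space n :: (nat \<Rightarrow> 'a::{field,finite}) set) = n"
proof -
  have "CARD('a) ^ fun_vs.dim (coord_space n :: (nat \<Rightarrow> 'a) set) = CARD('a) ^ n"
    using fun_vs.card_subspace[OF subspace_coord_space finite_coord_space] card_coord_space[of n, where 'a = 'a]
    by metis
  then show ?thesis
    using fun_vs.card_field_gt_1[where 'a = 'a] by (simp add: power_inject_exp)
qed

section \<open>Coordinates of a characteristic polynomial with respect to \<open>chi\<close>\<close>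

definition chi_coord :: "nat \<Rightarrow> (nat \<Rightarrow> 'a::{field,finite}) set list \<Rightarrow> nat \<Rightarrow> real" where
  "chi_coord n Hs k = (\<Sum>A\<in>Pow {..<length Hs}. (-1) ^ card A *
     newton_coeff CARD('a)
       (real CARD('a) ^ fun_vs.dim (coord_space n \<inter> (\<Inter>i\<in>A. Hs ! i)) / real CARD('a) ^ n) k)"

context
  fixes n :: nat and Hs :: "(nat \<Rightarrow> 'a::{field,finite}) set list"
  assumes arr: "hyperplane_arrangement n Hs"
begin

interpretation hyperplane_family scale_fun "coord_space n" "{..<length Hs}" "(!) Hs" "real CARD('a)"
  using arr nth_mem
  by unfold_locales
    (auto simp: hyperplane_arrangement_def linear_hyperplane_def subspace_coord_space
      finite_coord_space dim_coord_space)

lemma dim_flat_le: "A \<subseteq> {..<length Hs} \<Longrightarrow> fun_vs.dim (flat A) \<le> n"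
  using fun_vs.dim_subset_finite[OF subspace_flat subspace_V finite_V finite_field flat_subset]
  by (simp add: dim_coord_space)

lemma dim_flat_less:
  assumes "A \<subseteq> {..<length Hs}" "A \<noteq> {}"
  shows "fun_vs.dim (flat A) < n"
proof -
  obtain j where j: "j \<in> A" "j < length Hs" using assms by auto
  then have "flat A \<subseteq> Hs ! j" by (auto simp: flat_def)
  moreover have "finite (Hs ! j)" using H_subset[of j] j finite_V by (auto intro: finite_subset)
  ultimately have "fun_vs.dim (flat A) \<le> fun_vs.dim (Hs ! j)"
    using fun_vs.dim_subset_finite[OF subspace_flat[OF assms(1)] subspace_H] j finite_field by simp
  then show ?thesis using dim_H[of j] j by (simp add: dim_coord_space)
qed

lemma characteristic_poly_eq_flat:
  "characteristic_poly n Hs =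
    (\<Sum>A\<in>Pow {..<length Hs}. (-1) ^ card A *\<^sub>R monom 1 (fun_vs.dim (flat A)))"
proof -
  have "(-1) ^ m * p = (-1) ^ m *\<^sub>R p" for m and p :: "real poly"
    by (cases "even m") (simp_all add: scaleR_real_poly)
  then show ?thesis by (simp add: characteristic_poly_def flat_def)
qed

lemma characteristic_poly_eq_sum_chi:
  "characteristic_poly n Hs = (\<Sum>k\<le>n. chi_coord n Hs k *\<^sub>R chi CARD('a) n k)"
proof -
  have "characteristic_poly n Hs = (\<Sum>A\<in>Pow {..<length Hs}. (-1) ^ card A *\<^sub>R
      (\<Sum>k\<le>n. newton_coeff CARD('a) (real CARD('a) ^ fun_vs.dim (flat A) / real CARD('a) ^ n) k
        *\<^sub>R chi CARD('a) n k))"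
    unfolding characteristic_poly_eq_flat
    using monom_eq_sum_chi[of _ n "CARD('a)"] dim_flat_le q_gt_1
    by (intro sum.cong refl arg_cong2[of _ _ _ _ scaleR]) auto
  also have "\<dots> = (\<Sum>k\<le>n. chi_coord n Hs k *\<^sub>R chi CARD('a) n k)"
    unfolding chi_coord_def scaleR_sum_left flat_def[symmetric] scaleR_sum_right
    by (subst sum.swap) simp
  finally show ?thesis .
qed

text \<open>Compare coefficients of \<open>t ^ n\<close>: every \<open>chi\<close> has coefficient 1
  there, and in the characteristic polynomial only the empty intersection reaches dimension
  \<open>n\<close>.\<close>

lemma sum_chi_coord: "(\<Sum>k\<le>n. chi_coord n Hs k) = 1"
proof -
  have "coeff (characteristic_poly n Hs) n = (\<Sum>k\<le>n. chi_coord n Hs k)"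
    unfolding characteristic_poly_eq_sum_chi
    by (simp add: coeff_sum scaleR_real_poly coeff_chi_top)
  moreover have "coeff (characteristic_poly n Hs) n =
      (\<Sum>A\<in>Pow {..<length Hs}. (-1) ^ card A * of_bool (fun_vs.dim (flat A) = n))"
    unfolding characteristic_poly_eq_flat
    by (simp add: coeff_sum scaleR_real_poly of_bool_def)
  moreover have "\<dots> = (\<Sum>A\<in>{{}}. (-1) ^ card A * of_bool (fun_vs.dim (flat A) = n))"
    by (rule sum.mono_neutral_right) (auto dest: dim_flat_less)
  moreover have "\<dots> = 1"
    by (simp add: flat_empty dim_coord_space)
  ultimately show ?thesis by simp
qed

lemma chi_coord_eq_wavoid:
  obtains c where "c > 0" "chi_coord n Hs k = c * ((-1) ^ k * wavoid k {0})"
proof -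
  let ?q = "real CARD('a)"
  \<comment> \<open>This collects the part of the Newton coefficient that does not depend on the
    flat; the numerators leave one sign per factor, which gives \<open>(-1) ^ k\<close>.\<close>
  define c where "c = (\<Prod>j<k. ?q / (?q ^ n * (?q ^ Suc j - 1)))"
  have "?q / (?q ^ n * (?q ^ Suc j - 1)) > 0" for j
    using q_gt_1 one_less_power[of ?q "Suc j"] by simp
  then have "c > 0" unfolding c_def by (intro prod_pos) blast
  have "newton_coeff ?q (?q ^ d / ?q ^ n) k =
      c * ((-1) ^ k * (\<Prod>j<k. ?q ^ n - ?q ^ (d + j)))" for d
  proof -
    have "newton_coeff ?q (?q ^ d / ?q ^ n) k =
        (\<Prod>j<k. ?q / (?q ^ n * (?q ^ Suc j - 1)) * (- 1 * (?q ^ n - ?q ^ (d + j))))"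
      unfolding newton_coeff_def
    proof (rule prod.cong[OF refl])
      fix j
      have "?q ^ d / ?q ^ n * ?q ^ j - 1 = - 1 * (?q ^ n - ?q ^ (d + j)) / ?q ^ n"
        using q_gt_1 by (simp add: field_simps power_add)
      then show "?q * (?q ^ d / ?q ^ n * ?q ^ j - 1) / (?q ^ Suc j - 1) =
          ?q / (?q ^ n * (?q ^ Suc j - 1)) * (- 1 * (?q ^ n - ?q ^ (d + j)))"
        by simp
    qed
    then show ?thesis
      by (simp only: prod.distrib c_def prod_constant card_lessThan)
  qed
  \<comment> \<open>So for \<open>Y = {0}\<close> the indicator in \<open>wavoid\<close> is always 1
    and the sums agree term by term.\<close>
  moreover have "{0} \<inter> flat A = {0}" if "A \<subseteq> {..<length Hs}" for A
    using fun_vs.subspace_0[OF subspace_flat[OF that]] by simp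
  ultimately have "chi_coord n Hs k = c * ((-1) ^ k * wavoid k {0})"
    unfolding chi_coord_def wavoid_def flat_def[symmetric] sum_distrib_left
    by (intro sum.cong refl) (simp add: dim_coord_space)
  with \<open>c > 0\<close> show thesis by (rule that)
qed

lemma chi_coord_nonneg: "chi_coord n Hs k \<ge> 0"
proof -
  have "0 \<le> (-1) ^ k * wavoid k {0}"
  proof (rule wavoid_sign)
    fix Y :: "(nat \<Rightarrow> 'a) set"
    assume "fun_vs.subspace Y" "Y \<subseteq> coord_space n" "fun_vs.dim Y = fun_vs.dim {0} + k"
    then show "0 \<le> (-1) ^ k * avoid {..<length Hs} Y"
      using avoid_sign[of "{..<length Hs}" Y] by simp
  qed (use fun_vs.subspace_0[OF subspace_coord_space] in auto)
  moreover obtain c where "c > 0" "chi_coord n Hs k = c * ((-1) ^ k * wavoid k {0})"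
    by (rule chi_coord_eq_wavoid)
  ultimately show ?thesis by simp
qed

lemma chi_coord_eq_0:
  assumes "\<And>Y. fun_vs.subspace Y \<Longrightarrow> Y \<subseteq> coord_space n \<Longrightarrow> fun_vs.dim Y = k \<Longrightarrow>
      (\<exists>H\<in>set Hs. Y \<subseteq> H) \<or> (\<exists>v\<in>Y. v \<noteq> 0 \<and> (\<forall>H\<in>set Hs. v \<in> H))"
  shows "chi_coord n Hs k = 0"
proof -
  have *: "avoid {..<length Hs} Y = 0"
    if Y: "fun_vs.subspace Y" "Y \<subseteq> coord_space n" "fun_vs.dim Y = fun_vs.dim {0} + k"
    for Y :: "(nat \<Rightarrow> 'a) set"
  proof -
    consider H where "H \<in> set Hs" "Y \<subseteq> H" | v where "v \<in> Y" "v \<noteq> 0" "\<And>H. H \<in> set Hs \<Longrightarrow> v \<in> H"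
      using assms[of Y] Y by auto
    then show ?thesis
    proof cases
      case 1
      then obtain j where "j < length Hs" "Y \<subseteq> Hs ! j" by (auto simp: in_set_conv_nth)
      then show ?thesis using avoid_eq_0[of "{..<length Hs}" j Y] by simp
    next
      case 2
      then have "v \<in> Y \<inter> flat A" if "A \<subseteq> {..<length Hs}" for A
        using that Y by (auto simp: flat_def)
      then have "Y \<inter> flat A \<noteq> {0}" if "A \<subseteq> {..<length Hs}" for A
        using that 2(2) by blast
      then show ?thesis unfolding avoid_def by (intro sum.neutral) simp
    qed
  qed
  have sub: "fun_vs.subspace {0 :: nat \<Rightarrow> 'a}" "{0 :: nat \<Rightarrow> 'a} \<subseteq> coord_space n"
    using fun_vs.subspace_0[OF subspace_coord_space] by auto
  \<comment> \<open>All values of \<open>avoid\<close> in dimension \<open>k\<close> vanish, so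
    \<open>wavoid_sign\<close> applies with either sign and forces
    \<open>wavoid k {0} = 0\<close>.\<close>
  have "0 \<le> 1 * wavoid k {0}" "0 \<le> - 1 * wavoid k {0}"
    by (rule wavoid_sign[OF sub]; simp add: *)+
  moreover obtain c where "c > 0" "chi_coord n Hs k = c * ((-1) ^ k * wavoid k {0})"
    by (rule chi_coord_eq_wavoid)
  ultimately show ?thesis by simp
qed

end

section \<open>Arrangements realizing the vertices\<close>

lemma chi_attained:
  assumes "k \<le> n"
  obtains Hs :: "(nat \<Rightarrow> 'a::{field,finite}) set list"
    where "hyperplane_arrangement n Hs" "characteristic_poly n Hs = chi CARD('a) n k"
proof -
  let ?V = "coord_space n :: (nat \<Rightarrow> 'a) set"
  have "n - k \<le> fun_vs.dim ?V" by (simp add: dim_coord_space)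
  then obtain W where W: "fun_vs.subspace W" "W \<subseteq> ?V" "fun_vs.dim W = n - k"
    by (rule fun_vs.ex_subspace_dim[OF subspace_coord_space finite_coord_space])
  have fW: "finite W" using W(2) finite_coord_space by (rule finite_subset)
  \<comment> \<open>The arrangement lists all hyperplanes through \<open>W\<close> in some order;
    for \<open>k = 0\<close> there are none and the list is empty.\<close>
  have "finite {H :: (nat \<Rightarrow> 'a) set. linear_hyperplane n H \<and> W \<subseteq> H}"
    by (rule finite_subset[of _ "Pow ?V"]) (auto simp: linear_hyperplane_def finite_coord_space)
  from finite_list[OF this]
  obtain Hs where Hs: "set Hs = {H :: (nat \<Rightarrow> 'a) set. linear_hyperplane n H \<and> W \<subseteq> H}" ..
  then have arr: "hyperplane_arrangement n Hs"
    by (simp add: hyperplane_arrangement_def)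
  have zero: "chi_coord n Hs j = 0" if j: "j \<le> n" "j \<noteq> k" for j
  proof (rule chi_coord_eq_0[OF arr])
    fix Y :: "(nat \<Rightarrow> 'a) set"
    assume Y: "fun_vs.subspace Y" "Y \<subseteq> ?V" "fun_vs.dim Y = j"
    have fY: "finite Y" using Y(2) finite_coord_space by (rule finite_subset)
    define S where "S = {x + y |x y. x \<in> Y \<and> y \<in> W}"
    have S: "fun_vs.subspace S" "S \<subseteq> ?V"
      unfolding S_def using Y W subspace_coord_space
      by (auto intro!: fun_vs.subspace_sums fun_vs.subspace_add)
    have YS: "Y \<subseteq> S"
    proof
      fix y assume "y \<in> Y"
      moreover have "y = y + 0" by simp
      ultimately show "y \<in> S"
        unfolding S_def using fun_vs.subspace_0[OF W(1)] by blast
    qed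
    have WS: "W \<subseteq> S"
    proof
      fix w assume "w \<in> W"
      moreover have "w = 0 + w" by simp
      ultimately show "w \<in> S"
        unfolding S_def using fun_vs.subspace_0[OF Y(1)] by blast
    qed
    have dim: "fun_vs.dim S + fun_vs.dim (Y \<inter> W) = j + (n - k)"
      unfolding S_def using fun_vs.dim_sums_Int_finite[OF Y(1) W(1) fY fW] Y W by simp
    have "fun_vs.dim S \<le> n"
      using fun_vs.dim_subset_finite[OF S(1) subspace_coord_space finite_coord_space _ S(2)]
      by (simp add: dim_coord_space)
    \<comment> \<open>The two dimensions add up to \<open>n + j - k\<close>: for
      \<open>j < k\<close> the sum \<open>S\<close> is too small to be everything, and for
      \<open>j > k\<close> the intersection must be nontrivial.\<close>
    then consider "fun_vs.dim S < n" | "fun_vs.dim (Y \<inter> W) > 0"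
      using dim j assms by linarith
    then show "(\<exists>H\<in>set Hs. Y \<subseteq> H) \<or> (\<exists>v\<in>Y. v \<noteq> 0 \<and> (\<forall>H\<in>set Hs. v \<in> H))"
    proof cases
      case 1
      then have "S \<noteq> ?V" using dim_coord_space[of n, where 'a = 'a] by auto
      \<comment> \<open>A hyperplane containing \<open>S = Y + W\<close> contains \<open>W\<close>,
        so it belongs to the arrangement, and it contains \<open>Y\<close>.\<close>
      then obtain H where "fun_vs.subspace H" "S \<subseteq> H" "H \<subseteq> ?V" "fun_vs.dim H + 1 = fun_vs.dim ?V"
        using fun_vs.ex_hyperplane_superspace[OF S(1) subspace_coord_space S(2) _ finite_coord_space]
        by blast
      then have "H \<in> set Hs" "Y \<subseteq> H"
        using YS WS by (auto simp: Hs linear_hyperplane_def dim_coord_space)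
      then show ?thesis by blast
    next
      case 2
      then have "Y \<inter> W \<noteq> {0}"
        by (intro notI) (simp only: fun_vs.dim_zero less_irrefl)
      moreover have "0 \<in> Y \<inter> W"
        using fun_vs.subspace_0[OF W(1)] fun_vs.subspace_0[OF Y(1)] by simp
      ultimately obtain v where "v \<in> Y" "v \<in> W" "v \<noteq> 0" by blast
      then show ?thesis by (auto simp: Hs)
    qed
  qed
  \<comment> \<open>The coordinates add up to 1, so the only surviving one equals 1.\<close>
  have "(\<Sum>j\<le>n. chi_coord n Hs j) = (\<Sum>j\<in>{k}. chi_coord n Hs j)"
    using assms zero by (intro sum.mono_neutral_right) auto
  then have eq: "chi_coord n Hs k = 1" using sum_chi_coord[OF arr] by simp
  have "characteristic_poly n Hs = (\<Sum>j\<le>n. chi_coord n Hs j *\<^sub>R chi CARD('a) n j)"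
    by (rule characteristic_poly_eq_sum_chi[OF arr])
  also have "\<dots> = (\<Sum>j\<in>{k}. chi_coord n Hs j *\<^sub>R chi CARD('a) n j)"
    using assms zero by (intro sum.mono_neutral_right) auto
  also have "\<dots> = chi CARD('a) n k" by (simp add: eq)
  finally show thesis using arr that by blast
qed

section \<open>Convex combinations and the description of the hull\<close>

lemma convex_simplex_combinations:
  fixes p :: "nat \<Rightarrow> 'v::real_vector"
  shows "convex {\<Sum>k\<le>n. \<theta> k *\<^sub>R p k | \<theta> :: nat \<Rightarrow> real.
    (\<forall>k\<le>n. \<theta> k \<ge> 0) \<and> (\<Sum>k\<le>n. \<theta> k) = 1}"
proof (rule convexI, clarify)
  fix u v :: real and \<theta> \<eta> :: "nat \<Rightarrow> real"
  assume "0 \<le> u" "0 \<le> v" "u + v = 1"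
    and "\<forall>k\<le>n. \<theta> k \<ge> 0" "(\<Sum>k\<le>n. \<theta> k) = 1" "\<forall>k\<le>n. \<eta> k \<ge> 0" "(\<Sum>k\<le>n. \<eta> k) = 1"
  then show "\<exists>\<zeta>. u *\<^sub>R (\<Sum>k\<le>n. \<theta> k *\<^sub>R p k) + v *\<^sub>R (\<Sum>k\<le>n. \<eta> k *\<^sub>R p k) =
      (\<Sum>k\<le>n. \<zeta> k *\<^sub>R p k) \<and> (\<forall>k\<le>n. \<zeta> k \<ge> 0) \<and> (\<Sum>k\<le>n. \<zeta> k) = 1"
    by (intro exI[of _ "\<lambda>k. u * \<theta> k + v * \<eta> k"])
      (simp add: scaleR_sum_right scaleR_add_left sum.distrib flip: sum_distrib_left)
qed

theorem corollary7p6: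
  fixes n q :: nat
  assumes "q = CARD('a::{field, finite})"
  shows "convex hull
           {characteristic_poly n Hs | Hs :: (nat \<Rightarrow> 'a) set list. hyperplane_arrangement n Hs}
         = {\<Sum>k\<le>n. \<theta> k *\<^sub>R chi q n k | \<theta> :: nat \<Rightarrow> real.
              (\<forall>k\<le>n. \<theta> k \<ge> 0) \<and> (\<Sum>k\<le>n. \<theta> k) = 1}
         \<and> \<not> affine_dependent (chi q n ` {..n}) \<and> card (chi q n ` {..n}) = n + 1"
proof (intro conjI)
  let ?C = "{characteristic_poly n Hs | Hs :: (nat \<Rightarrow> 'a) set list. hyperplane_arrangement n Hs}"
  let ?S = "{\<Sum>k\<le>n. \<theta> k *\<^sub>R chi q n k | \<theta> :: nat \<Rightarrow> real.
              (\<forall>k\<le>n. \<theta> k \<ge> 0) \<and> (\<Sum>k\<le>n. \<theta> k) = 1}"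
  have q: "q > 0" using assms by simp
  \<comment> \<open>Together with the count of distinct points, this makes the set a genuine
    \<open>n\<close>-dimensional simplex.\<close>
  show "\<not> affine_dependent (chi q n ` {..n})" using q by (rule affine_independent_chi)
  show "card (chi q n ` {..n}) = n + 1" using inj_chi[OF q] by (simp add: card_image)
  show "convex hull ?C = ?S"
  proof
    have "?C \<subseteq> ?S"
    proof clarify
      fix Hs :: "(nat \<Rightarrow> 'a) set list"
      assume "hyperplane_arrangement n Hs"
      then show "\<exists>\<theta>. characteristic_poly n Hs = (\<Sum>k\<le>n. \<theta> k *\<^sub>R chi q n k) \<and>
          (\<forall>k\<le>n. \<theta> k \<ge> 0) \<and> (\<Sum>k\<le>n. \<theta> k) = 1"
        unfolding assms
        by (intro exI[of _ "chi_coord n Hs"])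
          (simp add: characteristic_poly_eq_sum_chi chi_coord_nonneg sum_chi_coord)
    qed
    then show "convex hull ?C \<subseteq> ?S"
      using convex_simplex_combinations by (rule hull_minimal)
  next
    show "?S \<subseteq> convex hull ?C"
    proof clarify
      fix \<theta> :: "nat \<Rightarrow> real"
      assume \<theta>: "\<forall>k\<le>n. \<theta> k \<ge> 0" "(\<Sum>k\<le>n. \<theta> k) = 1"
      \<comment> \<open>Each vertex is itself a characteristic polynomial, so every convex
        combination of vertices stays in the hull.\<close>
      have "chi q n k \<in> convex hull ?C" if "k \<le> n" for k
      proof -
        obtain Hs :: "(nat \<Rightarrow> 'a) set list"
          where "hyperplane_arrangement n Hs" "characteristic_poly n Hs = chi CARD('a) n k"
          using \<open>k \<le> n\<close> by (rule chi_attained)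
        then have "chi q n k \<in> ?C"
          unfolding assms by (metis (mono_tags, lifting) mem_Collect_eq)
        then show ?thesis by (rule hull_inc)
      qed
      then show "(\<Sum>k\<le>n. \<theta> k *\<^sub>R chi q n k) \<in> convex hull ?C"
        using \<theta> by (intro convex_sum convex_convex_hull) auto
    qed
  qed
qed

end
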